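(* Let $K$ be a field and let $n$ be a positive integer. If $K$ is locally finite or $n=1$, then $K^n$ is not $\mathrm{GA}(n,K)$-paradoxical.
   Context: A field is locally finite if each of its finitely generated subfields is finite. $\mathrm{GA}(n,K)$ is the group of all invertible affine maps $K^n\to K^n$, $x\mapsto Lx+\tau$ with $L\in\mathrm{GL}(n,K)$ and $\tau\in K^n$, acting naturally on $K^n$. Let $G$ be a group acting on a set $X$. A nonempty subset $E\subseteq X$ is $G$-paradoxical if for some positive integers $m,l$ there exist pairwise disjoint subsets $A_1,\dots,A_m,B_1,\dots,B_l$ of $E$ and elements $g_1,\dots,g_m,h_1,\dots,h_l\in G$ such that $E=A_1\sqcup\dots\sqcup A_m\sqcup B_1\sqcup\dots\sqcup B_l=\bigsqcup_{i=1}^m g_i(A_i)=\bigsqcup_{j=1}^l h_j(B_j)$, where $\sqcup$ and $\bigsqcup$ denote unions of pairwise disjoint sets. *)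

theory Defs
  imports
    "HOL-Analysis.Finite_Cartesian_Product"
    "HOL-Analysis.Cartesian_Space"
    "HOL-Algebra.Group_Action"
    "HOL-Algebra.Generated_Fields"
    "HOL-Algebra.Algebraic_Closure_Type"
begin

text \<open>Every finitely generated subfield of \<open>R\<close> has the form \<open>generate_field R S\<close> with \<open>S\<close> finite.\<close>

definition locally_finite_field :: "('a, 'b) ring_scheme \<Rightarrow> bool" where
  "locally_finite_field R \<longleftrightarrow>
     field R \<and> (\<forall>S. finite S \<and> S \<subseteq> carrier R \<longrightarrow> finite (generate_field R S))"

definition general_affine_group :: "('a::field ^ 'n \<Rightarrow> 'a ^ 'n) monoid" where
  "general_affine_group =
     \<lparr> carrier = {f. \<exists>L t. invertible L \<and> f = (\<lambda>x. L *v x + t)},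
       monoid.mult = (\<circ>), one = id \<rparr>"

text \<open>
  The group \<open>G\<close> acts on \<open>S\<close> by \<open>g \<cdot> x = \<phi> g x\<close>, as in the locale \<^locale>\<open>group_action\<close>.
  The pieces are indexed from 0 and may be empty.
\<close>

definition paradoxical ::
  "('g, 'm) monoid_scheme \<Rightarrow> 'x set \<Rightarrow> ('g \<Rightarrow> 'x \<Rightarrow> 'x) \<Rightarrow> 'x set \<Rightarrow> bool" where
  "paradoxical G S \<phi> E \<longleftrightarrow>
     E \<noteq> {} \<and> E \<subseteq> S \<and>
     (\<exists>m>0. \<exists>l>0. \<exists>(A :: nat \<Rightarrow> 'x set) (B :: nat \<Rightarrow> 'x set) (g :: nat \<Rightarrow> 'g) (h :: nat \<Rightarrow> 'g).
        (\<forall>i<m. A i \<subseteq> E \<and> g i \<in> carrier G) \<and>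
        (\<forall>j<l. B j \<subseteq> E \<and> h j \<in> carrier G) \<and>
        disjoint_family_on A {..<m} \<and>
        disjoint_family_on B {..<l} \<and>
        (\<forall>i<m. \<forall>j<l. A i \<inter> B j = {}) \<and>
        E = (\<Union>i<m. A i) \<union> (\<Union>j<l. B j) \<and>
        disjoint_family_on (\<lambda>i. \<phi> (g i) ` A i) {..<m} \<and>
        E = (\<Union>i<m. \<phi> (g i) ` A i) \<and>
        disjoint_family_on (\<lambda>j. \<phi> (h j) ` B j) {..<l} \<and>
        E = (\<Union>j<l. \<phi> (h j) ` B j))"

lemma affine_compose:
  fixes L M :: "'a::field ^ 'n ^ 'n"
  shows "(\<lambda>x. L *v x + s) \<circ> (\<lambda>x. M *v x + t) = (\<lambda>x. (L ** M) *v x + (L *v t + s))"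
  by (auto simp: fun_eq_iff matrix_vector_right_distrib matrix_vector_mul_assoc add.assoc)

lemma affineI: "invertible L \<Longrightarrow> (\<lambda>x. L *v x + t) \<in> carrier general_affine_group"
  by (auto simp: general_affine_group_def)

lemma affine_inverse:
  fixes f :: "'a::field ^ 'n \<Rightarrow> 'a ^ 'n"
  assumes "f \<in> carrier general_affine_group"
  obtains f' where "f' \<in> carrier general_affine_group" "f' \<circ> f = id" "f \<circ> f' = id"
proof -
  obtain L t where L: "invertible L" and f: "f = (\<lambda>x. L *v x + t)"
    using assms by (auto simp: general_affine_group_def)
  obtain M where M: "L ** M = mat 1" "M ** L = mat 1"
    using L unfolding invertible_def by blast
  define f' where "f' = (\<lambda>x. M *v x + (- (M *v t)))"
  have neg: "L *v (- u) = - (L *v u)" for u :: "'a ^ 'n"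
    by (metis add.right_inverse add_eq_0_iff matrix_vector_mult_0_right matrix_vector_right_distrib)
  have "invertible M" using M unfolding invertible_def by blast
  then have "f' \<in> carrier general_affine_group"
    unfolding f'_def by (rule affineI)
  moreover have "f' \<circ> f = id"
    unfolding f f'_def affine_compose by (simp add: M fun_eq_iff)
  moreover have "f \<circ> f' = id"
    unfolding f f'_def affine_compose by (simp add: M fun_eq_iff neg matrix_vector_mul_assoc)
  ultimately show thesis using that by blast
qed

lemma group_general_affine_group:
  "group (general_affine_group :: ('a::field ^ 'n \<Rightarrow> 'a ^ 'n) monoid)" (is "group ?G")
proof (rule groupI)
  fix f g assume "f \<in> carrier ?G" "g \<in> carrier ?G"
  then obtain L s M t where "invertible L" "f = (\<lambda>x. L *v x + s)"
      "invertible M" "g = (\<lambda>x. M *v x + t)"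
    by (auto simp: general_affine_group_def)
  then show "f \<otimes>\<^bsub>?G\<^esub> g \<in> carrier ?G"
    by (auto simp: general_affine_group_def affine_compose intro: invertible_mult)
next
  have "(\<lambda>x :: 'a ^ 'n. mat 1 *v x + 0) = \<one>\<^bsub>?G\<^esub>"
    by (simp add: general_affine_group_def fun_eq_iff)
  moreover have "invertible (mat 1 :: 'a ^ 'n ^ 'n)"
    unfolding invertible_def by (intro exI[of _ "mat 1"]) simp
  ultimately show "\<one>\<^bsub>?G\<^esub> \<in> carrier ?G"
    by (metis affineI)
next
  fix f assume "f \<in> carrier ?G"
  then obtain f' where "f' \<in> carrier ?G" "f' \<circ> f = id" by (rule affine_inverse)
  then show "\<exists>f' \<in> carrier ?G. f' \<otimes>\<^bsub>?G\<^esub> f = \<one>\<^bsub>?G\<^esub>"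
    by (auto simp: general_affine_group_def)
qed (auto simp: general_affine_group_def comp_assoc)

lemma group_action_general_affine_group:
  "group_action (general_affine_group :: ('a::field ^ 'n \<Rightarrow> 'a ^ 'n) monoid) UNIV (\<lambda>f. f)"
proof -
  let ?G = "general_affine_group :: ('a ^ 'n \<Rightarrow> 'a ^ 'n) monoid"
  have bij: "f \<in> Bij UNIV" if f: "f \<in> carrier ?G" for f
  proof -
    obtain f' where "f' \<circ> f = id" "f \<circ> f' = id" using f by (rule affine_inverse)
    then show ?thesis by (simp add: Bij_def o_bij)
  qed
  have "(\<lambda>f. f) \<in> hom ?G (BijGroup UNIV)"
    using bij
    by (auto simp: hom_def BijGroup_def general_affine_group_def compose_def fun_eq_iff)
  then show ?thesis
    unfolding group_action_def group_hom_def group_hom_axioms_def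
    using group_general_affine_group group_BijGroup by blast
qed

end

theory Submission
  imports Defs "HOL-Library.Indicator_Function"
begin

text \<open>
  The obstruction to a paradoxical decomposition is an averaging argument. Suppose that the finitely
  many group elements in a decomposition almost preserve the uniform weight on some nonempty finite
  list of points. Then moving a piece hardly changes its weight. But the original pieces together
  have the weight of the whole space, and the moved pieces have twice that weight
  (\<open>not_paradoxical_if_almost_invariant\<close>). So it suffices to find, for every finite set of affine
  maps and every \<open>\<epsilon> > 0\<close>, a list that these maps preserve up to the proportion \<open>\<epsilon>\<close>.

  If \<open>K\<close> is locally finite, the coefficients of finitely many affine maps lie in a finite subfield \<open>F\<close>. The maps
  permute the finite set \<open>F\<^sup>n\<close>, which is an exactly invariant list
  (\<open>affine_maps_finite_invariant_set\<close>).

  If \<open>n = 1\<close>, every affine map is a homothety \<open>x \<mapsto> a x + b\<close>, and these form a metabelian group: the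
  abelian group of translations is normal, with the abelian group of scalings as quotient. Orbits of
  commuting maps contain almost invariant lists, namely boxes of exponents with long sides
  (\<open>commuting_maps_almost_invariant\<close>). For the homotheties one first chooses such a box of scalings
  \<open>\<sigma>\<close> and then, depending on it, a box of translates \<open>v\<close> of \<open>0\<close>; the points \<open>\<sigma> v\<close> form the list
  (\<open>homotheties_almost_invariant\<close>).
\<close>

section \<open>Almost invariant lists of points\<close>

text \<open>
  This is a Foelner condition for the uniform weight on \<open>xs\<close>, counted with multiplicity. The one-sided
  inequality is equivalent to the two-sided one, as \<open>f\<close> may be replaced by \<open>1 - f\<close>. Repetitions are
  allowed because different exponents in a box may give the same point.
\<close>

definition almost_invariant :: "('x \<Rightarrow> 'x) set \<Rightarrow> real \<Rightarrow> 'x list \<Rightarrow> bool" where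
  "almost_invariant \<Gamma> \<epsilon> xs \<longleftrightarrow>
     (\<forall>\<gamma>\<in>\<Gamma>. \<forall>f. (\<forall>y. 0 \<le> f y \<and> f y \<le> 1) \<longrightarrow>
        (\<Sum>x\<leftarrow>xs. f x) \<le> (\<Sum>x\<leftarrow>xs. f (\<gamma> x)) + \<epsilon> * real (length xs))"

lemma almost_invariantD:
  assumes "almost_invariant \<Gamma> \<epsilon> xs" "\<gamma> \<in> \<Gamma>" "\<And>y. 0 \<le> f y" "\<And>y. f y \<le> (1::real)"
  shows "(\<Sum>x\<leftarrow>xs. f x) \<le> (\<Sum>x\<leftarrow>xs. f (\<gamma> x)) + \<epsilon> * real (length xs)"
  using assms unfolding almost_invariant_def by blast

lemma sum_list_swap:
  "(\<Sum>x\<leftarrow>xs. \<Sum>y\<leftarrow>ys. f x y) = (\<Sum>y\<leftarrow>ys. \<Sum>x\<leftarrow>xs. f x y :: real)"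
  by (induction xs) (simp_all add: sum_list_addf)

lemma sum_list_sum_swap:
  "(\<Sum>x\<leftarrow>xs. \<Sum>i<m. f x i) = (\<Sum>i<m::nat. \<Sum>x\<leftarrow>xs. f x i :: real)"
  by (induction xs) (simp_all add: sum.distrib)

lemma sum_indicator_partition:
  assumes "disjoint_family_on A {..<m::nat}"
  shows "(\<Sum>i<m. indicator (A i) x) = (indicator (\<Union>i<m. A i) x :: real)"
  by (rule indicator_UN_disjoint[symmetric]) (use assms in auto)

text \<open>
  Every \<open>g\<close> in the group is injective, so the indicator of \<open>g ` A\<close> at \<open>g x\<close> is that of \<open>A\<close> at \<open>x\<close>.
  Applying almost invariance to the indicator of \<open>g ` A\<close> thus bounds the weight of \<open>g ` A\<close> by the
  weight of \<open>A\<close> up to the error \<open>\<epsilon> n\<close>, where \<open>n\<close> is the length of the list. Summed over the \<open>m + l\<close>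
  pieces this reads \<open>2 n \<le> n + (m + l) \<epsilon> n\<close>.
\<close>

lemma not_paradoxical_if_almost_invariant:
  fixes G :: "('x \<Rightarrow> 'x, 'm) monoid_scheme"
  assumes inj: "\<And>g. g \<in> carrier G \<Longrightarrow> inj g"
    and almost: "\<And>\<Gamma> \<epsilon>. finite \<Gamma> \<Longrightarrow> \<Gamma> \<subseteq> carrier G \<Longrightarrow> \<epsilon> > 0 \<Longrightarrow>
          \<exists>xs. xs \<noteq> [] \<and> almost_invariant \<Gamma> \<epsilon> xs"
  shows "\<not> paradoxical G UNIV (\<lambda>g. g) UNIV"
proof
  assume "paradoxical G UNIV (\<lambda>g. g) UNIV"
  then obtain m l :: nat and A B :: "nat \<Rightarrow> 'x set" and g h where
      UN: "UNIV = (\<Union>i<m. A i) \<union> (\<Union>j<l. B j)"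
      and gA: "disjoint_family_on (\<lambda>i. g i ` A i) {..<m}" "UNIV = (\<Union>i<m. g i ` A i)"
      and hB: "disjoint_family_on (\<lambda>j. h j ` B j) {..<l}" "UNIV = (\<Union>j<l. h j ` B j)"
      and A: "disjoint_family_on A {..<m}" and B: "disjoint_family_on B {..<l}"
      and AB: "\<forall>i<m. \<forall>j<l. A i \<inter> B j = {}"
      and gG: "\<And>i. i < m \<Longrightarrow> g i \<in> carrier G" and hG: "\<And>j. j < l \<Longrightarrow> h j \<in> carrier G"
    unfolding paradoxical_def by (elim exE conjE) (rule that, assumption+, blast+)
  \<comment> \<open>Small enough for the \<open>m + l\<close> errors to add up to less than the whole weight.\<close>
  define \<epsilon> :: real where "\<epsilon> = 1 / (real (m + l) + 1)"
  define \<Gamma> where "\<Gamma> = g ` {..<m} \<union> h ` {..<l}"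
  have "\<epsilon> > 0" by (simp add: \<epsilon>_def add_pos_nonneg)
  moreover have "finite \<Gamma>" "\<Gamma> \<subseteq> carrier G"
    using gG hG by (auto simp: \<Gamma>_def)
  ultimately obtain xs where xs: "xs \<noteq> []" "almost_invariant \<Gamma> \<epsilon> xs"
    using almost by blast
  define n where "n = real (length xs)"
  have n: "n > 0" using xs(1) by (simp add: n_def)
  have move: "(\<Sum>x\<leftarrow>xs. indicator (k ` C) x) \<le> (\<Sum>x\<leftarrow>xs. indicator C x) + \<epsilon> * n"
    if "k \<in> \<Gamma>" for k C
  proof -
    have "inj k" using that \<open>\<Gamma> \<subseteq> carrier G\<close> inj by blast
    then have "(indicator (k ` C) (k x) :: real) = indicator C x" for x
      by (simp add: indicator_def inj_image_mem_iff)
    then show ?thesis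
      using almost_invariantD[OF xs(2) that, of "indicator (k ` C)"] by (simp add: n_def)
  qed
  have cover: "(\<Sum>i<k. \<Sum>x\<leftarrow>xs. indicator (C i) x) = n"
    if "disjoint_family_on C {..<k::nat}" "UNIV = (\<Union>i<k. C i)" for C k
    unfolding sum_list_sum_swap[symmetric] sum_indicator_partition[OF that(1)] that(2)[symmetric]
    by (simp add: n_def sum_list_triv)
  have "n + n = (\<Sum>i<m. \<Sum>x\<leftarrow>xs. indicator (g i ` A i) x) + (\<Sum>j<l. \<Sum>x\<leftarrow>xs. indicator (h j ` B j) x)"
    using cover[OF gA] cover[OF hB] by simp
  also have "\<dots> \<le> (\<Sum>i<m. (\<Sum>x\<leftarrow>xs. indicator (A i) x) + \<epsilon> * n) + (\<Sum>j<l. (\<Sum>x\<leftarrow>xs. indicator (B j) x) + \<epsilon> * n)"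
    by (intro add_mono sum_mono move) (auto simp: \<Gamma>_def)
  also have "\<dots> = (\<Sum>x\<leftarrow>xs. indicator (\<Union>i<m. A i) x + indicator (\<Union>j<l. B j) x) + real (m + l) * \<epsilon> * n"
    by (simp add: sum.distrib sum_list_sum_swap[symmetric] sum_indicator_partition A B
        sum_list_addf algebra_simps)
  also have "(\<lambda>x. indicator (\<Union>i<m. A i) x + indicator (\<Union>j<l. B j) x :: real) = (\<lambda>x. 1)"
  proof
    fix x
    have "(\<Union>i<m. A i) \<inter> (\<Union>j<l. B j) = {}" using AB by blast
    then show "indicator (\<Union>i<m. A i) x + indicator (\<Union>j<l. B j) x = (1::real)"
      using indicator_disj_union[of "\<Union>i<m. A i" "\<Union>j<l. B j" x] UN[symmetric] by simp
  qed
  also have "(\<Sum>x\<leftarrow>xs. 1) = n" by (simp add: n_def sum_list_triv)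
  finally have "n \<le> (real (m + l) * \<epsilon>) * n" by simp
  moreover have "real (m + l) * \<epsilon> < 1" by (simp add: \<epsilon>_def)
  ultimately show False using n by simp
qed

section \<open>Commuting maps\<close>

text \<open>
  The maps \<open>c\<close> in \<open>C\<close> are treated one at a time: a family \<open>ms\<close> that works for the previous ones is
  replaced by all \<open>c\<^sup>j \<circ> m\<close> with \<open>j < N\<close>. Since \<open>c\<^sup>j\<close> commutes with the previous maps, it can be absorbed
  into the test function \<open>f\<close>, so their bound survives. Applying \<open>c\<close> itself shifts the index \<open>j\<close>,
  which changes only the two end terms; for \<open>N \<ge> 1 / \<epsilon>\<close> this is within the bound. The maps \<open>ms\<close> are
  found before the point \<open>x\<close>, because their use for homotheties needs the same \<open>ms\<close> at many points.
\<close>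

lemma commuting_maps_almost_invariant:
  fixes S C :: "('x \<Rightarrow> 'x) set"
  assumes id: "id \<in> S" and comp: "\<And>p q. p \<in> S \<Longrightarrow> q \<in> S \<Longrightarrow> p \<circ> q \<in> S"
    and comm: "\<And>p q. p \<in> S \<Longrightarrow> q \<in> S \<Longrightarrow> p \<circ> q = q \<circ> p"
    and C: "finite C" "C \<subseteq> S" and \<epsilon>: "\<epsilon> > 0"
  shows "\<exists>ms. ms \<noteq> [] \<and> set ms \<subseteq> S \<and> (\<forall>x. almost_invariant C \<epsilon> (map (\<lambda>m. m x) ms))"
  using C
proof (induction C rule: finite_induct)
  case empty
  then show ?case
    using id by (intro exI[of _ "[id]"]) (simp add: almost_invariant_def)
next
  case (insert c C)
  then obtain ms where ms: "ms \<noteq> []" "set ms \<subseteq> S"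
      "\<And>x. almost_invariant C \<epsilon> (map (\<lambda>m. m x) ms)"
    by blast
  obtain N :: nat where N: "1 < real N * \<epsilon>"
    using \<epsilon> reals_Archimedean3 by blast
  then have "N \<noteq> 0" by (intro notI) simp
  define ms' where "ms' = concat (map (\<lambda>j. map (\<lambda>m. (c ^^ j) \<circ> m) ms) [0..<N])"
  have pow: "c ^^ j \<in> S" for j
    using insert.prems id comp by (induction j) (auto simp: id_def[symmetric])
  have len: "length ms' = N * length ms"
    by (simp add: ms'_def length_concat o_def sum_list_triv)
  have sum_ms': "(\<Sum>m\<leftarrow>ms'. F m) = (\<Sum>j<N. \<Sum>m\<leftarrow>ms. F ((c ^^ j) \<circ> m))" for F :: "_ \<Rightarrow> real"
    unfolding ms'_def
    by (induction N) (simp_all add: o_def)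
  have "almost_invariant (insert c C) \<epsilon> (map (\<lambda>m. m x) ms')" for x
    unfolding almost_invariant_def
  proof (intro ballI allI impI)
    fix \<gamma> and f :: "'x \<Rightarrow> real"
    assume \<gamma>: "\<gamma> \<in> insert c C" and f: "\<forall>y. 0 \<le> f y \<and> f y \<le> 1"
    \<comment> \<open>The weight of \<open>f\<close> on the layer of \<open>ms'\<close> with exponent \<open>j\<close>.\<close>
    define g where "g j = (\<Sum>m\<leftarrow>ms. f ((c ^^ j) (m x)))" for j
    have g: "0 \<le> g j" "g j \<le> real (length ms)" for j
      using f sum_list_mono[of ms "\<lambda>m. f ((c ^^ j) (m x))" "\<lambda>_. 1"]
      by (auto simp: g_def sum_list_triv intro!: sum_list_nonneg)
    have "(\<Sum>j<N. g j) \<le> (\<Sum>j<N. \<Sum>m\<leftarrow>ms. f (\<gamma> ((c ^^ j) (m x)))) + \<epsilon> * (real N * real (length ms))"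
    proof (cases "\<gamma> = c")
      case True
      have "(\<Sum>j<N. g j) = (\<Sum>j<N. g (Suc j)) + (g 0 - g N)"
        using sum_lessThan_telescope'[of g N] by (simp add: sum_subtractf)
      also have "g 0 - g N \<le> real (length ms)"
        using g(1)[of N] g(2)[of 0] by simp
      also have "\<dots> \<le> (real N * \<epsilon>) * real (length ms)"
        using N by (simp add: mult_le_cancel_right1)
      finally show ?thesis
        by (simp add: True g_def mult_ac)
    next
      case False
      then have "\<gamma> \<in> C" using \<gamma> by simp
      have swap: "\<gamma> ((c ^^ j) y) = (c ^^ j) (\<gamma> y)" for j y
        using comm[OF _ pow, of \<gamma> j] \<open>\<gamma> \<in> C\<close> insert.prems by (auto simp: fun_eq_iff)
      have "(\<Sum>j<N. g j) \<le> (\<Sum>j<N. (\<Sum>m\<leftarrow>ms. f ((c ^^ j) (\<gamma> (m x)))) + \<epsilon> * real (length ms))"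
        using almost_invariantD[OF ms(3) \<open>\<gamma> \<in> C\<close>, of "\<lambda>y. f ((c ^^ _) y)"] f
        by (intro sum_mono) (simp add: g_def o_def)
      then show ?thesis
        by (simp add: swap sum.distrib mult_ac)
    qed
    then show "(\<Sum>x\<leftarrow>map (\<lambda>m. m x) ms'. f x)
        \<le> (\<Sum>x\<leftarrow>map (\<lambda>m. m x) ms'. f (\<gamma> x)) + \<epsilon> * real (length (map (\<lambda>m. m x) ms'))"
      by (simp add: sum_ms'[where F = "\<lambda>m. f (m x)", unfolded o_def]
          sum_ms'[where F = "\<lambda>m. f (\<gamma> (m x))", unfolded o_def] len g_def o_def)
  qed
  moreover have "ms' \<noteq> []"
    using len \<open>N \<noteq> 0\<close> ms(1) by (metis length_0_conv mult_is_0)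
  moreover have "set ms' \<subseteq> S"
    using ms(2) pow comp by (auto simp: ms'_def)
  ultimately show ?case by blast
qed

section \<open>Homotheties\<close>

text \<open>
  A scaling in general distorts a box of translates, so the scalings must be chosen before the box.
  Let \<open>\<gamma> x = a x + b\<close>. For a scaling \<open>\<sigma>\<close> with factor \<open>c\<close>, one has
  \<open>\<gamma> (\<sigma> v) = a \<sigma> (v + d)\<close> with \<open>d = b / (a c)\<close>. Once the finite list of scalings \<open>\<sigma>\<close> is fixed, only finitely
  many translations \<open>d\<close> occur, and the points \<open>v\<close> can be chosen almost invariant under all of them.
  Passing from \<open>f (\<sigma> v)\<close> to \<open>f (a \<sigma> v)\<close> and from there to \<open>f (a \<sigma> (v + d))\<close> costs \<open>\<epsilon> / 2\<close> each.
\<close>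

lemma homotheties_almost_invariant:
  fixes \<Gamma> :: "('a::field ^ 'n \<Rightarrow> 'a ^ 'n) set"
  assumes fin: "finite \<Gamma>" and \<epsilon>: "\<epsilon> > 0"
    and form: "\<And>\<gamma>. \<gamma> \<in> \<Gamma> \<Longrightarrow> \<exists>a b. a \<noteq> 0 \<and> \<gamma> = (\<lambda>x. a *s x + b)"
  shows "\<exists>xs. xs \<noteq> [] \<and> almost_invariant \<Gamma> \<epsilon> xs"
proof -
  obtain a b where ab: "\<And>\<gamma>. \<gamma> \<in> \<Gamma> \<Longrightarrow> a \<gamma> \<noteq> 0" "\<And>\<gamma> x. \<gamma> \<in> \<Gamma> \<Longrightarrow> \<gamma> x = a \<gamma> *s x + b \<gamma>"
    using form by metis
  define S :: "('a ^ 'n \<Rightarrow> 'a ^ 'n) set" where "S = {\<lambda>x. s *s x |s. s \<noteq> 0}"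
  have "\<exists>ms. ms \<noteq> [] \<and> set ms \<subseteq> S \<and>
      (\<forall>x. almost_invariant ((\<lambda>\<gamma> x. a \<gamma> *s x) ` \<Gamma>) (\<epsilon> / 2) (map (\<lambda>m. m x) ms))"
  proof (rule commuting_maps_almost_invariant)
    show "id \<in> S"
      by (auto simp: S_def fun_eq_iff intro!: exI[of _ 1])
    show "p \<circ> q \<in> S" if "p \<in> S" "q \<in> S" for p q
    proof -
      from that obtain s t where "s \<noteq> 0" "t \<noteq> 0" "p = (\<lambda>x. s *s x)" "q = (\<lambda>x. t *s x)"
        by (auto simp: S_def)
      then show ?thesis
        by (auto simp: S_def fun_eq_iff vector_smult_assoc intro!: exI[of _ "s * t"])
    qed
    show "p \<circ> q = q \<circ> p" if "p \<in> S" "q \<in> S" for p q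
      using that by (auto simp: S_def fun_eq_iff vector_smult_assoc mult.commute)
  qed (use fin \<epsilon> ab in \<open>auto simp: S_def\<close>)
  then obtain \<sigma>s where \<sigma>s: "\<sigma>s \<noteq> []" "set \<sigma>s \<subseteq> S"
      "\<And>x. almost_invariant ((\<lambda>\<gamma> x. a \<gamma> *s x) ` \<Gamma>) (\<epsilon> / 2) (map (\<lambda>\<sigma>. \<sigma> x) \<sigma>s)"
    by blast
  have "\<forall>\<sigma>\<in>set \<sigma>s. \<exists>s. s \<noteq> 0 \<and> \<sigma> = (\<lambda>x. s *s x)"
    using \<sigma>s(2) by (auto simp: S_def)
  then obtain c where c: "\<And>\<sigma>. \<sigma> \<in> set \<sigma>s \<Longrightarrow> c \<sigma> \<noteq> 0" "\<And>\<sigma> x. \<sigma> \<in> set \<sigma>s \<Longrightarrow> \<sigma> x = c \<sigma> *s x"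
    by metis
  define d where "d \<gamma> \<sigma> = inverse (a \<gamma> * c \<sigma>) *s b \<gamma>" for \<gamma> \<sigma>
  have d: "\<gamma> (\<sigma> v) = a \<gamma> *s \<sigma> (v + d \<gamma> \<sigma>)" if "\<gamma> \<in> \<Gamma>" "\<sigma> \<in> set \<sigma>s" for \<gamma> \<sigma> v
  proof -
    have "(a \<gamma> * c \<sigma>) *s d \<gamma> \<sigma> = b \<gamma>"
      using ab(1)[OF that(1)] c(1)[OF that(2)]
      by (simp add: d_def vector_smult_assoc del: inverse_mult_distrib)
    then show ?thesis
      using that by (simp add: ab(2) c(2) vector_add_ldistrib vector_smult_assoc)
  qed
  have "\<exists>ms. ms \<noteq> [] \<and> set ms \<subseteq> range (\<lambda>t x. x + t) \<and>
      (\<forall>x::'a ^ 'n. almost_invariant ((\<lambda>(\<gamma>, \<sigma>) x. x + d \<gamma> \<sigma>) ` (\<Gamma> \<times> set \<sigma>s)) (\<epsilon> / 2) (map (\<lambda>m. m x) ms))"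
  proof (rule commuting_maps_almost_invariant)
    show "id \<in> range (\<lambda>t x. x + t :: 'a ^ 'n)"
      by (rule range_eqI[of _ _ 0]) auto
    show "p \<circ> q \<in> range (\<lambda>t x. x + t)" if "p \<in> range (\<lambda>t x. x + t)" "q \<in> range (\<lambda>t x. x + t)"
      for p q :: "'a ^ 'n \<Rightarrow> 'a ^ 'n"
    proof -
      from that obtain s t where "p = (\<lambda>x. x + s)" "q = (\<lambda>x. x + t)"
        by auto
      then show ?thesis
        by (intro range_eqI[of _ _ "t + s"]) (auto simp: add.assoc)
    qed
    show "p \<circ> q = q \<circ> p" if "p \<in> range (\<lambda>t x. x + t)" "q \<in> range (\<lambda>t x. x + t)"
      for p q :: "'a ^ 'n \<Rightarrow> 'a ^ 'n"
      using that by (auto simp: fun_eq_iff add_ac)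
  qed (use fin \<epsilon> in auto)
  then obtain \<tau>s where \<tau>s: "\<tau>s \<noteq> []"
      "\<And>x::'a ^ 'n. almost_invariant ((\<lambda>(\<gamma>, \<sigma>) x. x + d \<gamma> \<sigma>) ` (\<Gamma> \<times> set \<sigma>s)) (\<epsilon> / 2) (map (\<lambda>\<tau>. \<tau> x) \<tau>s)"
    by blast
  define vs where "vs = map (\<lambda>\<tau>. \<tau> 0) \<tau>s"
  define xs where "xs = concat (map (\<lambda>\<sigma>. map \<sigma> vs) \<sigma>s)"
  have len: "length xs = length \<sigma>s * length vs"
    by (simp add: xs_def length_concat o_def sum_list_triv)
  have sum_xs: "(\<Sum>x\<leftarrow>xs. F x) = (\<Sum>\<sigma>\<leftarrow>\<sigma>s. \<Sum>v\<leftarrow>vs. F (\<sigma> v))" for F :: "_ \<Rightarrow> real"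
    unfolding xs_def by (induction \<sigma>s) (simp_all add: o_def)
  have "almost_invariant \<Gamma> \<epsilon> xs"
    unfolding almost_invariant_def
  proof (intro ballI allI impI)
    fix \<gamma> and f :: "'a ^ 'n \<Rightarrow> real"
    assume \<gamma>: "\<gamma> \<in> \<Gamma>" and f: "\<forall>y. 0 \<le> f y \<and> f y \<le> 1"
    have scale: "(\<Sum>\<sigma>\<leftarrow>\<sigma>s. f (\<sigma> v)) \<le> (\<Sum>\<sigma>\<leftarrow>\<sigma>s. f (a \<gamma> *s \<sigma> v)) + \<epsilon> / 2 * length \<sigma>s" for v
      using almost_invariantD[OF \<sigma>s(3) imageI[OF \<gamma>], of f] f by (simp add: o_def)
    have translate: "(\<Sum>v\<leftarrow>vs. f (a \<gamma> *s \<sigma> v)) \<le> (\<Sum>v\<leftarrow>vs. f (\<gamma> (\<sigma> v))) + \<epsilon> / 2 * length vs"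
      if "\<sigma> \<in> set \<sigma>s" for \<sigma>
    proof -
      have "(\<lambda>x. x + d \<gamma> \<sigma>) \<in> (\<lambda>(\<gamma>, \<sigma>) x. x + d \<gamma> \<sigma>) ` (\<Gamma> \<times> set \<sigma>s)"
        using \<gamma> that by (intro image_eqI[of _ _ "(\<gamma>, \<sigma>)"]) simp_all
      from almost_invariantD[OF \<tau>s(2) this, of "\<lambda>y. f (a \<gamma> *s \<sigma> y)" 0] f
      show ?thesis
        by (simp add: o_def vs_def d[OF \<gamma> that])
    qed
    have "(\<Sum>x\<leftarrow>xs. f x) = (\<Sum>v\<leftarrow>vs. \<Sum>\<sigma>\<leftarrow>\<sigma>s. f (\<sigma> v))"
      by (simp add: sum_xs sum_list_swap[of _ vs])
    also have "\<dots> \<le> (\<Sum>v\<leftarrow>vs. (\<Sum>\<sigma>\<leftarrow>\<sigma>s. f (a \<gamma> *s \<sigma> v)) + \<epsilon> / 2 * length \<sigma>s)"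
      by (intro sum_list_mono scale)
    also have "\<dots> = (\<Sum>\<sigma>\<leftarrow>\<sigma>s. \<Sum>v\<leftarrow>vs. f (a \<gamma> *s \<sigma> v)) + \<epsilon> / 2 * length xs"
      by (simp add: sum_list_addf sum_list_triv sum_list_swap[of _ vs] len mult_ac)
    also have "(\<Sum>\<sigma>\<leftarrow>\<sigma>s. \<Sum>v\<leftarrow>vs. f (a \<gamma> *s \<sigma> v))
        \<le> (\<Sum>\<sigma>\<leftarrow>\<sigma>s. (\<Sum>v\<leftarrow>vs. f (\<gamma> (\<sigma> v))) + \<epsilon> / 2 * length vs)"
      by (intro sum_list_mono translate)
    also have "\<dots> = (\<Sum>x\<leftarrow>xs. f (\<gamma> x)) + \<epsilon> / 2 * length xs"
      by (simp add: sum_xs sum_list_addf sum_list_triv len mult_ac)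
    finally show "(\<Sum>x\<leftarrow>xs. f x) \<le> (\<Sum>x\<leftarrow>xs. f (\<gamma> x)) + \<epsilon> * real (length xs)"
      by linarith
  qed
  moreover have "xs \<noteq> []"
    using len \<sigma>s(1) \<tau>s(1) by (metis length_0_conv mult_is_0 vs_def map_is_Nil_conv)
  ultimately show ?thesis by blast
qed

text \<open>The only entry of an invertible matrix of size one is a unit, and it acts as a scalar.\<close>

lemma affine_dim_1_homothety:
  fixes f :: "'a::field ^ 'n \<Rightarrow> 'a ^ 'n"
  assumes "CARD('n) = 1" and "f \<in> carrier general_affine_group"
  shows "\<exists>a b. a \<noteq> 0 \<and> f = (\<lambda>x. a *s x + b)"
proof -
  obtain L t where L: "invertible L" "f = (\<lambda>x. L *v x + t)"
    using assms(2) by (auto simp: general_affine_group_def)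
  obtain M where "L ** M = mat 1" using L(1) unfolding invertible_def by blast
  obtain i :: 'n where i: "UNIV = {i}" using assms(1) by (metis card_1_singletonE)
  then have all: "k = i" for k by blast
  have "L $ i $ i * M $ i $ i = (L ** M) $ i $ i"
    by (simp add: matrix_matrix_mult_def i)
  also have "\<dots> = 1" by (simp add: \<open>L ** M = mat 1\<close> mat_def)
  finally have "L $ i $ i \<noteq> 0" by auto
  moreover have "(L *v x) $ k = (L $ i $ i *s x) $ k" for x k
    using all[of k] by (simp add: matrix_vector_mult_def i)
  then have "f = (\<lambda>x. L $ i $ i *s x + t)"
    unfolding L(2) by (metis vec_eq_iff)
  ultimately show ?thesis by blast
qed

section \<open>Affine maps over a locally finite field\<close>

text \<open>An injective map of a finite set into itself permutes it, so sums over the set do not change.\<close>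

lemma finite_invariant_set_almost_invariant:
  fixes \<Gamma> :: "('x \<Rightarrow> 'x) set" and Y :: "'x set" and \<epsilon> :: real
  assumes "finite Y" "Y \<noteq> {}" and inj: "\<And>\<gamma>. \<gamma> \<in> \<Gamma> \<Longrightarrow> inj \<gamma>"
    and into: "\<And>\<gamma>. \<gamma> \<in> \<Gamma> \<Longrightarrow> \<gamma> ` Y \<subseteq> Y" and "\<epsilon> \<ge> 0"
  shows "\<exists>xs. xs \<noteq> [] \<and> almost_invariant \<Gamma> \<epsilon> xs"
proof -
  obtain xs where xs: "set xs = Y" "distinct xs"
    using finite_distinct_list[OF assms(1)] by blast
  have "almost_invariant \<Gamma> \<epsilon> xs"
    unfolding almost_invariant_def
  proof (intro ballI allI impI)
    fix \<gamma> and f :: "_ \<Rightarrow> real"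
    assume "\<gamma> \<in> \<Gamma>"
    then have "inj_on \<gamma> Y" using inj inj_on_subset by blast
    moreover have "\<gamma> ` Y = Y"
      using endo_inj_surj[OF assms(1) into[OF \<open>\<gamma> \<in> \<Gamma>\<close>] \<open>inj_on \<gamma> Y\<close>] .
    ultimately have "sum f Y = (\<Sum>x\<in>Y. f (\<gamma> x))"
      using sum.reindex[of \<gamma> Y f] by (simp add: o_def)
    then show "(\<Sum>x\<leftarrow>xs. f x) \<le> (\<Sum>x\<leftarrow>xs. f (\<gamma> x)) + \<epsilon> * real (length xs)"
      using xs \<open>\<epsilon> \<ge> 0\<close> by (simp add: sum_list_distinct_conv_sum_set)
  qed
  then show ?thesis using xs(1) assms(2) by auto
qed

lemma finite_vectors_with_entries_in:
  assumes "finite F"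
  shows "finite {x :: 'a ^ 'n. \<forall>i. x $ i \<in> F}"
proof -
  have "{x :: 'a ^ 'n. \<forall>i. x $ i \<in> F} \<subseteq> vec_lambda ` (UNIV \<rightarrow>\<^sub>E F)"
    by (auto intro!: image_eqI[of _ _ "vec_nth _"] simp: PiE_def)
  then show ?thesis
    using assms by (meson finite_PiE finite finite_imageI finite_subset)
qed

lemma locally_finite_field_finite_subring:
  fixes S :: "'a::field set"
  assumes "locally_finite_field (ring_of_type_algebra :: 'a ring)" and "finite S"
  obtains F where "finite F" "S \<subseteq> F" "0 \<in> F"
    "\<And>x y. x \<in> F \<Longrightarrow> y \<in> F \<Longrightarrow> x + y \<in> F" "\<And>x y. x \<in> F \<Longrightarrow> y \<in> F \<Longrightarrow> x * y \<in> F"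
proof
  let ?R = "ring_of_type_algebra :: 'a ring"
  let ?F = "generate_field ?R S"
  interpret field ?R using assms(1) by (simp add: locally_finite_field_def)
  have S: "S \<subseteq> carrier ?R" by (simp add: ring_of_type_algebra_def)
  show "finite ?F" using assms S by (simp add: locally_finite_field_def)
  show "S \<subseteq> ?F" by (auto intro: generate_field.incl)
  interpret subfield ?F ?R using generate_field_is_subfield[OF S] .
  show "0 \<in> ?F"
    using subring_props(2)[OF subfield_axioms] by (simp add: ring_of_type_algebra_def)
  show "x + y \<in> ?F" if "x \<in> ?F" "y \<in> ?F" for x y
    using generate_field.eng_add[OF that] by (simp add: ring_of_type_algebra_def)
  show "x * y \<in> ?F" if "x \<in> ?F" "y \<in> ?F" for x y
    using generate_field.eng_mult[OF that] by (simp add: ring_of_type_algebra_def)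
qed

text \<open>
  The set is \<open>F\<^sup>n\<close> for a finite subfield \<open>F\<close> that contains all matrix entries and all coordinates of the
  translation parts.
\<close>

lemma affine_maps_finite_invariant_set:
  fixes \<Gamma> :: "('a::field ^ 'n \<Rightarrow> 'a ^ 'n) set"
  assumes "locally_finite_field (ring_of_type_algebra :: 'a ring)"
    and "finite \<Gamma>" "\<Gamma> \<subseteq> carrier general_affine_group"
  obtains Y where "finite Y" "Y \<noteq> {}" "\<And>\<gamma>. \<gamma> \<in> \<Gamma> \<Longrightarrow> \<gamma> ` Y \<subseteq> Y"
proof -
  have "\<forall>\<gamma>\<in>\<Gamma>. \<exists>L t. \<gamma> = (\<lambda>x. L *v x + t)"
    using assms(3) by (fastforce simp: general_affine_group_def)
  then obtain L t where \<gamma>: "\<And>\<gamma> x. \<gamma> \<in> \<Gamma> \<Longrightarrow> \<gamma> x = L \<gamma> *v x + t \<gamma>"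
    by metis
  define S where "S = (\<Union>\<gamma>\<in>\<Gamma>. range (\<lambda>(i, j). L \<gamma> $ i $ j) \<union> range (\<lambda>i. t \<gamma> $ i))"
  have "finite S" using assms(2) by (auto simp: S_def)
  then obtain F where F: "finite F" "S \<subseteq> F" "0 \<in> F"
      "\<And>x y. x \<in> F \<Longrightarrow> y \<in> F \<Longrightarrow> x + y \<in> F" "\<And>x y. x \<in> F \<Longrightarrow> y \<in> F \<Longrightarrow> x * y \<in> F"
    using locally_finite_field_finite_subring[OF assms(1)] by metis
  have sum: "sum f I \<in> F" if "\<And>i. f i \<in> F" for f and I :: "'n set"
    by (induction I rule: infinite_finite_induct) (auto simp: F that)
  define Y where "Y = {x :: 'a ^ 'n. \<forall>i. x $ i \<in> F}"
  show thesis
  proof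
    show "finite Y" unfolding Y_def by (rule finite_vectors_with_entries_in[OF F(1)])
    have "0 \<in> Y" by (simp add: Y_def F)
    then show "Y \<noteq> {}" by blast
    fix \<gamma> assume "\<gamma> \<in> \<Gamma>"
    have "t \<gamma> $ i \<in> S" for i
      unfolding S_def by (intro UN_I[OF \<open>\<gamma> \<in> \<Gamma>\<close>] UnI2 rangeI)
    moreover have "L \<gamma> $ i $ j \<in> S" for i j
      unfolding S_def by (intro UN_I[OF \<open>\<gamma> \<in> \<Gamma>\<close>] UnI1 range_eqI[of _ _ "(i, j)"]) simp
    ultimately have "L \<gamma> $ i $ j \<in> F" "t \<gamma> $ i \<in> F" for i j
      using F(2) by blast+
    then show "\<gamma> ` Y \<subseteq> Y"
      using \<gamma>[OF \<open>\<gamma> \<in> \<Gamma>\<close>] by (auto simp: Y_def matrix_vector_mult_def intro!: F(4,5) sum)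
  qed
qed

theorem theorem3p14:
  assumes "locally_finite_field (ring_of_type_algebra :: 'a::field ring) \<or> CARD('n::finite) = 1"
  shows "\<not> paradoxical (general_affine_group :: ('a ^ 'n \<Rightarrow> 'a ^ 'n) monoid)
            (UNIV :: ('a ^ 'n) set) (\<lambda>f. f) (UNIV :: ('a ^ 'n) set)"
proof (rule not_paradoxical_if_almost_invariant)
  let ?G = "general_affine_group :: ('a ^ 'n \<Rightarrow> 'a ^ 'n) monoid"
  show inj: "inj g" if "g \<in> carrier ?G" for g
    using that by (metis affine_inverse inj_on_id inj_on_imageI2)
  fix \<Gamma> and \<epsilon> :: real
  assume \<Gamma>: "finite \<Gamma>" "\<Gamma> \<subseteq> carrier ?G" and \<epsilon>: "\<epsilon> > 0"
  show "\<exists>xs. xs \<noteq> [] \<and> almost_invariant \<Gamma> \<epsilon> xs"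
    using assms
  proof
    assume "CARD('n) = 1"
    then show ?thesis
      using homotheties_almost_invariant[OF \<Gamma>(1) \<epsilon>] affine_dim_1_homothety \<Gamma>(2) by blast
  next
    assume "locally_finite_field (ring_of_type_algebra :: 'a ring)"
    then obtain Y where "finite Y" "Y \<noteq> {}" "\<And>\<gamma>. \<gamma> \<in> \<Gamma> \<Longrightarrow> \<gamma> ` Y \<subseteq> Y"
      using affine_maps_finite_invariant_set \<Gamma> by metis
    then show ?thesis
      using inj \<Gamma>(2) \<epsilon> by (intro finite_invariant_set_almost_invariant[of Y]) auto
  qed
qed

end
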